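(* Let $\mathfrak g$ be a Lie algebra and $(V;\rho)$ a representation of $\mathfrak g$. If $(d,N)$ is a DN-structure on $\mathfrak g$ with respect to $(V;\rho)$ and $d$ is invertible, then $(T=N\circ d^{-1},d)$ is a KD-structure on $\mathfrak g$ with respect to $(V;\rho)$. Conversely, if $(T,d)$ is a KD-structure on $\mathfrak g$ with respect to $(V;\rho)$, then $(d,N=T\circ d)$ is a DN-structure on $\mathfrak g$ with respect to $(V;\rho)$.
   Context: Everything is over a ground field $\mathbb K$. Let $\mathfrak g$ be a Lie algebra and $\rho:\mathfrak g\to\mathfrak{gl}(V)$ a representation, denoted $(V;\rho)$. A relative differential operator (with respect to $(V;\rho)$) is a linear map $d:\mathfrak g\to V$ with $d[x,y]=\rho(x)d(y)-\rho(y)d(x)$ for all $x,y\in\mathfrak g$. An $\mathcal O$-operator (with respect to $(V;\rho)$) is a linear map $T:V\to\mathfrak g$ with $[Tu,Tv]=T(\rho(Tu)v-\rho(Tv)u)$ for all $u,v\in V$. A Nijenhuis operator on $\mathfrak g$ is a linear map $N:\mathfrak g\to\mathfrak g$ with $[N(x),N(y)]=N\big([N(x),y]+[x,N(y)]-N[x,y]\big)$ for all $x,y\in\mathfrak g$. A DN-structure is a pair $(d,N)$, where $d$ is a relative differential operator with respect to $(V;\rho)$ and $N$ is a Nijenhuis operator on $\mathfrak g$, such that $d\circ N$ is also a relative differential operator with respect to $(V;\rho)$. A KD-structure is a pair $(T,d)$, where $T$ is an $\mathcal O$-operator and $d$ a relative differential operator (both with respect to $(V;\rho)$), such that, with $N:=T\circ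 d$, the map $d\circ N$ is also a relative differential operator with respect to $(V;\rho)$. *)

theory Defs
  imports Main "HOL.Vector_Spaces"
begin

locale lie_algebra = vector_space scale
  for scale :: "'k::field \<Rightarrow> 'g::ab_group_add \<Rightarrow> 'g" +
  fixes bracket :: "'g \<Rightarrow> 'g \<Rightarrow> 'g"
  assumes linear_bracket_left: "Vector_Spaces.linear scale scale (\<lambda>x. bracket x y)"
    and linear_bracket_right: "Vector_Spaces.linear scale scale (bracket x)"
    and bracket_self: "bracket x x = 0"
    and jacobi: "bracket x (bracket y z) + bracket y (bracket z x) + bracket z (bracket x y) = 0"

text \<open>The first two assumptions on \<open>\<rho>\<close> say that it is a linear map into the linear
  endomorphisms of \<open>V\<close>; the third, that it respects the commutator bracket of \<open>gl(V)\<close>.\<close>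

locale lie_representation =
  lie_algebra scale bracket + V: vector_space scaleV
  for scale :: "'k::field \<Rightarrow> 'g::ab_group_add \<Rightarrow> 'g"
    and bracket :: "'g \<Rightarrow> 'g \<Rightarrow> 'g"
    and scaleV :: "'k \<Rightarrow> 'v::ab_group_add \<Rightarrow> 'v" +
  fixes \<rho> :: "'g \<Rightarrow> 'v \<Rightarrow> 'v"
  assumes linear_action: "Vector_Spaces.linear scaleV scaleV (\<rho> x)"
    and linear_rho: "Vector_Spaces.linear scale scaleV (\<lambda>x. \<rho> x v)"
    and rho_bracket: "\<rho> (bracket x y) v = \<rho> x (\<rho> y v) - \<rho> y (\<rho> x v)"

definition nijenhuis_operator ::
  "('k::field \<Rightarrow> 'g::ab_group_add \<Rightarrow> 'g) \<Rightarrow> ('g \<Rightarrow> 'g \<Rightarrow> 'g) \<Rightarrow> ('g \<Rightarrow> 'g) \<Rightarrow> bool" where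
  "nijenhuis_operator scale bracket N \<longleftrightarrow>
     Vector_Spaces.linear scale scale N \<and>
     (\<forall>x y. bracket (N x) (N y) = N (bracket (N x) y + bracket x (N y) - N (bracket x y)))"

definition relative_differential_operator ::
  "('k::field \<Rightarrow> 'g::ab_group_add \<Rightarrow> 'g) \<Rightarrow> ('g \<Rightarrow> 'g \<Rightarrow> 'g) \<Rightarrow>
   ('k \<Rightarrow> 'v::ab_group_add \<Rightarrow> 'v) \<Rightarrow> ('g \<Rightarrow> 'v \<Rightarrow> 'v) \<Rightarrow> ('g \<Rightarrow> 'v) \<Rightarrow> bool" where
  "relative_differential_operator scale bracket scaleV \<rho> d \<longleftrightarrow>
     Vector_Spaces.linear scale scaleV d \<and>
     (\<forall>x y. d (bracket x y) = \<rho> x (d y) - \<rho> y (d x))"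

definition O_operator ::
  "('k::field \<Rightarrow> 'g::ab_group_add \<Rightarrow> 'g) \<Rightarrow> ('g \<Rightarrow> 'g \<Rightarrow> 'g) \<Rightarrow>
   ('k \<Rightarrow> 'v::ab_group_add \<Rightarrow> 'v) \<Rightarrow> ('g \<Rightarrow> 'v \<Rightarrow> 'v) \<Rightarrow> ('v \<Rightarrow> 'g) \<Rightarrow> bool" where
  "O_operator scale bracket scaleV \<rho> T \<longleftrightarrow>
     Vector_Spaces.linear scaleV scale T \<and>
     (\<forall>u v. bracket (T u) (T v) = T (\<rho> (T u) v - \<rho> (T v) u))"

definition DN_structure ::
  "('k::field \<Rightarrow> 'g::ab_group_add \<Rightarrow> 'g) \<Rightarrow> ('g \<Rightarrow> 'g \<Rightarrow> 'g) \<Rightarrow>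
   ('k \<Rightarrow> 'v::ab_group_add \<Rightarrow> 'v) \<Rightarrow> ('g \<Rightarrow> 'v \<Rightarrow> 'v) \<Rightarrow> ('g \<Rightarrow> 'v) \<Rightarrow> ('g \<Rightarrow> 'g) \<Rightarrow> bool" where
  "DN_structure scale bracket scaleV \<rho> d N \<longleftrightarrow>
     relative_differential_operator scale bracket scaleV \<rho> d \<and>
     nijenhuis_operator scale bracket N \<and>
     relative_differential_operator scale bracket scaleV \<rho> (d \<circ> N)"

definition KD_structure ::
  "('k::field \<Rightarrow> 'g::ab_group_add \<Rightarrow> 'g) \<Rightarrow> ('g \<Rightarrow> 'g \<Rightarrow> 'g) \<Rightarrow>
   ('k \<Rightarrow> 'v::ab_group_add \<Rightarrow> 'v) \<Rightarrow> ('g \<Rightarrow> 'v \<Rightarrow> 'v) \<Rightarrow> ('v \<Rightarrow> 'g) \<Rightarrow> ('g \<Rightarrow> 'v) \<Rightarrow> bool" where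
  "KD_structure scale bracket scaleV \<rho> T d \<longleftrightarrow>
     O_operator scale bracket scaleV \<rho> T \<and>
     relative_differential_operator scale bracket scaleV \<rho> d \<and>
     (let N = T \<circ> d in relative_differential_operator scale bracket scaleV \<rho> (d \<circ> N))"

end

theory Submission
  imports Defs
begin

text \<open>The Nijenhuis condition on \<open>N\<close> says that the bracket of two values of \<open>N\<close> is \<open>N\<close> applied
  to the deformed bracket \<open>B x y = [N x, y] + [x, N y] - N [x, y]\<close>. The point of the proof is that,
  as soon as \<open>d\<close> and \<open>d \<circ> N\<close> are both relative differential operators,
  \<open>d (B x y) = \<rho> (N x) (d y) - \<rho> (N y) (d x)\<close> (lemma \<open>d_deformed_bracket\<close>). If \<open>N = T \<circ> d\<close>,
  applying \<open>T\<close> to this identity gives \<open>N (B x y) = T (\<rho> (T u) v - \<rho> (T v) u)\<close> for \<open>u = d x\<close> and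
  \<open>v = d y\<close>: the Nijenhuis identity for \<open>N\<close> at \<open>(x, y)\<close> is the \<open>\<O>\<close>-operator identity for \<open>T\<close> at
  \<open>(d x, d y)\<close>. Thus an \<open>\<O>\<close>-operator \<open>T\<close> always yields a Nijenhuis operator; a Nijenhuis operator
  controls \<open>T\<close> only on the range of \<open>d\<close>, so the other direction uses that \<open>d\<close> is onto.
  Injectivity of \<open>d\<close> ensures that \<open>T = N \<circ> d\<inverse>\<close> satisfies \<open>T \<circ> d = N\<close>.\<close>

text \<open>The terms \<open>\<rho> x (d (N y))\<close> and \<open>\<rho> y (d (N x))\<close> arise both from \<open>d ([N x, y] + [x, N y])\<close> and
  from \<open>(d \<circ> N) [x, y]\<close>, and cancel.\<close>

lemma d_deformed_bracket:
  assumes d: "relative_differential_operator scale bracket scaleV \<rho> d"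
    and dN: "relative_differential_operator scale bracket scaleV \<rho> (d \<circ> N)"
  shows "d (bracket (N x) y + bracket x (N y) - N (bracket x y)) = \<rho> (N x) (d y) - \<rho> (N y) (d x)"
proof -
  interpret d: Vector_Spaces.linear scale scaleV d
    using d by (simp add: relative_differential_operator_def)
  have leibniz: "d (bracket a b) = \<rho> a (d b) - \<rho> b (d a)" for a b
    using d by (simp add: relative_differential_operator_def)
  have "d (N (bracket x y)) = \<rho> x (d (N y)) - \<rho> y (d (N x))"
    using dN by (simp add: relative_differential_operator_def)
  then show ?thesis
    by (simp add: d.add d.diff leibniz)
qed

lemma linear_inv_if_bij:
  assumes "Vector_Spaces.linear s1 s2 f" and "bij f"
  shows "Vector_Spaces.linear s2 s1 (inv f)"
proof -
  interpret Vector_Spaces.linear s1 s2 f by fact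
  have f_inv: "f (inv f y) = y" for y
    using \<open>bij f\<close> by (simp add: bij_is_surj surj_f_inv_f)
  have inv_eqI: "inv f y = x" if "f x = y" for x y
    using that \<open>bij f\<close> by (auto simp: bij_is_inj)
  show ?thesis
    by unfold_locales (auto intro!: inv_eqI simp: add scale f_inv)
qed

lemma DN_structure_imp_KD_structure:
  assumes DN: "DN_structure scale bracket scaleV \<rho> d N" and "bij d"
  shows "KD_structure scale bracket scaleV \<rho> (N \<circ> inv d) d"
proof -
  have d: "relative_differential_operator scale bracket scaleV \<rho> d"
    and N: "nijenhuis_operator scale bracket N"
    and dN: "relative_differential_operator scale bracket scaleV \<rho> (d \<circ> N)"
    using DN by (simp_all add: DN_structure_def)
  have inv_d: "inv d (d x) = x" for x
    using \<open>bij d\<close> by (simp add: bij_is_inj)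
  have "Vector_Spaces.linear scaleV scale (inv d)"
    using d \<open>bij d\<close> by (simp add: relative_differential_operator_def linear_inv_if_bij)
  then have "Vector_Spaces.linear scaleV scale (N \<circ> inv d)"
    using N by (simp add: nijenhuis_operator_def Vector_Spaces.linear_compose)
  moreover have "bracket ((N \<circ> inv d) u) ((N \<circ> inv d) v)
      = (N \<circ> inv d) (\<rho> ((N \<circ> inv d) u) v - \<rho> ((N \<circ> inv d) v) u)" for u v
  proof -
    obtain x y where uv: "u = d x" "v = d y"
      using \<open>bij d\<close> by (meson bij_pointE)
    have "bracket (N x) (N y) = N (bracket (N x) y + bracket x (N y) - N (bracket x y))"
      using N by (simp add: nijenhuis_operator_def)
    also have "\<dots> = (N \<circ> inv d) (\<rho> (N x) (d y) - \<rho> (N y) (d x))"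
      by (simp add: inv_d flip: d_deformed_bracket[OF d dN])
    finally show ?thesis
      by (simp add: uv inv_d)
  qed
  moreover have "(N \<circ> inv d) \<circ> d = N"
    by (simp add: fun_eq_iff inv_d)
  ultimately show ?thesis
    using d dN by (simp add: KD_structure_def O_operator_def Let_def)
qed

lemma KD_structure_imp_DN_structure:
  assumes KD: "KD_structure scale bracket scaleV \<rho> T d"
  shows "DN_structure scale bracket scaleV \<rho> d (T \<circ> d)"
proof -
  have T: "O_operator scale bracket scaleV \<rho> T"
    and d: "relative_differential_operator scale bracket scaleV \<rho> d"
    and dN: "relative_differential_operator scale bracket scaleV \<rho> (d \<circ> (T \<circ> d))"
    using KD by (simp_all add: KD_structure_def Let_def)
  have "Vector_Spaces.linear scale scale (T \<circ> d)"
    using T d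
    by (auto simp: O_operator_def relative_differential_operator_def
        intro: Vector_Spaces.linear_compose)
  moreover have "bracket ((T \<circ> d) x) ((T \<circ> d) y)
      = (T \<circ> d) (bracket ((T \<circ> d) x) y + bracket x ((T \<circ> d) y) - (T \<circ> d) (bracket x y))" for x y
  proof -
    have "bracket (T (d x)) (T (d y)) = T (\<rho> (T (d x)) (d y) - \<rho> (T (d y)) (d x))"
      using T by (simp add: O_operator_def)
    then show ?thesis
      using d_deformed_bracket[OF d dN, of x y] by simp
  qed
  ultimately show ?thesis
    using d dN by (simp add: DN_structure_def nijenhuis_operator_def)
qed

theorem proposition3p5:
  fixes scale :: "'k::field \<Rightarrow> 'g::ab_group_add \<Rightarrow> 'g"
    and bracket :: "'g \<Rightarrow> 'g \<Rightarrow> 'g"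
    and scaleV :: "'k \<Rightarrow> 'v::ab_group_add \<Rightarrow> 'v"
    and \<rho> :: "'g \<Rightarrow> 'v \<Rightarrow> 'v"
  assumes "lie_algebra scale bracket"
    and "lie_representation scale bracket scaleV \<rho>"
  shows "(\<forall>d N. DN_structure scale bracket scaleV \<rho> d N \<and> bij d \<longrightarrow>
            KD_structure scale bracket scaleV \<rho> (N \<circ> inv d) d) \<and>
         (\<forall>T d. KD_structure scale bracket scaleV \<rho> T d \<longrightarrow>
            DN_structure scale bracket scaleV \<rho> d (T \<circ> d))"
  using DN_structure_imp_KD_structure KD_structure_imp_DN_structure by blast

end
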